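(* Let $f:\mathbb{C}^n\to\mathbb{R}$ be real-analytic (as a function on $\mathbb{R}^{2n}$), and suppose that at a given point of $\mathbb{C}^n$ the matrices $\mathcal{H}_{\mathbf{r}\mathbf{r}}$, $\mathcal{H}^{\mathbb{C}}_{\mathbf{c}\mathbf{c}}$ and $\mathcal{H}^{\mathbb{R}}_{\mathbf{c}\mathbf{c}}$ are invertible. Define at that point the Newton updates $$\widehat{\Delta\mathbf{r}}=-\left(\mathcal{H}_{\mathbf{r}\mathbf{r}}\right)^{-1}\left(\frac{\partial f}{\partial\mathbf{r}}\right)^T,\qquad \widehat{\Delta\mathbf{c}^{\mathbb{C}}}=-\left(\mathcal{H}^{\mathbb{C}}_{\mathbf{c}\mathbf{c}}\right)^{-1}\left(\frac{\partial f}{\partial\mathbf{c}}\right)^H,\qquad \widehat{\Delta\mathbf{c}^{\mathbb{R}}}=-\left(\mathcal{H}^{\mathbb{R}}_{\mathbf{c}\mathbf{c}}\right)^{-1}\left(\frac{\partial f}{\partial\mathbf{c}}\right)^T.$$ Then $\widehat{\Delta\mathbf{c}^{\mathbb{C}}}\in\mathcal{C}$ and $$\widehat{\Delta\mathbf{c}^{\mathbb{C}}}=\widehat{\Delta\mathbf{c}^{\mathbb{R}}}=\mathsf{J}\,\widehat{\Delta\mathbf{r}}.$$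
   Context: Here $j=\sqrt{-1}$, a bar is entrywise complex conjugation, and ${}^H$ is conjugate transpose. Write $\mathbf{z}=\mathbf{x}+j\mathbf{y}\in\mathbb{C}^n$, $\mathbf{r}=(\mathbf{x}^T,\mathbf{y}^T)^T\in\mathbb{R}^{2n}$, and $\mathbf{c}=(\mathbf{z}^T,\bar{\mathbf{z}}^T)^T$. Let $\mathcal{C}=\left\{\begin{pmatrix}\mathbf{w}\\ \bar{\mathbf{w}}\end{pmatrix}:\mathbf{w}\in\mathbb{C}^n\right\}\subset\mathbb{C}^{2n}$ and $\mathsf{J}=\begin{pmatrix}I&jI\\ I&-jI\end{pmatrix}$, with $I$ the $n\times n$ identity. Define the row operators $\frac{\partial}{\partial\mathbf{z}}=\frac12\left(\frac{\partial}{\partial\mathbf{x}}-j\frac{\partial}{\partial\mathbf{y}}\right)$, $\frac{\partial}{\partial\bar{\mathbf{z}}}=\frac12\left(\frac{\partial}{\partial\mathbf{x}}+j\frac{\partial}{\partial\mathbf{y}}\right)$, $\frac{\partial}{\partial\mathbf{c}}=\left(\frac{\partial}{\partial\mathbf{z}},\frac{\partial}{\partial\bar{\mathbf{z}}}\right)$ and $\frac{\partial}{\partial\mathbf{r}}=\left(\frac{\partial}{\partial\mathbf{x}},\frac{\partial}{\partial\mathbf{y}}\right)$. Applied to a column-vector-valued function $F$, such an operator gives the matrix whose $(k,l)$ entry is the $l$-th component operator applied to $F_k$. Define $$\mathcal{H}_{\mathbf{r}\mathbf{r}}=\frac{\partial}{\partial\mathbf{r}}\left(\frac{\partial f}{\partial\mathbf{r}}\right)^T,\quad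 \mathcal{H}^{\mathbb{C}}_{\mathbf{c}\mathbf{c}}=\frac{\partial}{\partial\mathbf{c}}\left(\frac{\partial f}{\partial\mathbf{c}}\right)^H,\quad \mathcal{H}^{\mathbb{R}}_{\mathbf{c}\mathbf{c}}=\frac{\partial}{\partial\mathbf{c}}\left(\frac{\partial f}{\partial\mathbf{c}}\right)^T.$$ *)

theory Defs
  imports "HOL-Analysis.Analysis"
begin

text \<open>The index set of a vector of length 2n is the sum type \<open>'n + 'n\<close>: \<open>Inl\<close> indexes the
  upper block, \<open>Inr\<close> the lower block. Rows and columns are both rendered as vectors, so
  transposing a row of partial derivatives is silent.\<close>

definition complexify :: "real ^ ('n + 'n) \<Rightarrow> complex ^ 'n" where
  "complexify r = (\<chi> k. Complex (r $ Inl k) (r $ Inr k))"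

definition conj_vec :: "complex ^ 'm \<Rightarrow> complex ^ 'm" where
  "conj_vec v = (\<chi> k. cnj (v $ k))"

definition of_real_vec :: "real ^ 'm \<Rightarrow> complex ^ 'm" where
  "of_real_vec v = (\<chi> k. complex_of_real (v $ k))"

definition augment :: "complex ^ 'n \<Rightarrow> complex ^ ('n + 'n)" where
  "augment w = (\<chi> i. case i of Inl k \<Rightarrow> w $ k | Inr k \<Rightarrow> cnj (w $ k))"

definition C_space :: "(complex ^ ('n::finite + 'n)) set" where
  "C_space = range augment"

definition J_mat :: "complex ^ ('n::finite + 'n) ^ ('n + 'n)" where
  "J_mat = (\<chi> a b. case a of
       Inl k \<Rightarrow> (case b of Inl l \<Rightarrow> mat 1 $ k $ l | Inr l \<Rightarrow> \<i> * (mat 1 $ k $ l))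
     | Inr k \<Rightarrow> (case b of Inl l \<Rightarrow> mat 1 $ k $ l | Inr l \<Rightarrow> - \<i> * (mat 1 $ k $ l)))"

text \<open>Around every point the function is the sum of a power series in several variables, indexed
  by multi-indices \<open>\<alpha> :: 'm \<Rightarrow> nat\<close>. Unconditional convergence in the sense of \<open>has_sum\<close> is
  absolute convergence here.\<close>

definition real_analytic :: "(real ^ 'm \<Rightarrow> real) \<Rightarrow> bool" where
  "real_analytic g \<longleftrightarrow> (\<forall>p. \<exists>e>0. \<exists>a :: ('m \<Rightarrow> nat) \<Rightarrow> real. \<forall>x\<in>ball p e.
     ((\<lambda>\<alpha>. a \<alpha> * (\<Prod>i\<in>UNIV. (x $ i - p $ i) ^ \<alpha> i)) has_sum g x) UNIV)"

definition d_x :: "'n \<Rightarrow> (complex ^ 'n \<Rightarrow> 'a) \<Rightarrow> complex ^ 'n \<Rightarrow> 'a::real_normed_vector" where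
  "d_x k F z = vector_derivative (\<lambda>t::real. F (z + t *\<^sub>R axis k 1)) (at 0)"

definition d_y :: "'n \<Rightarrow> (complex ^ 'n \<Rightarrow> 'a) \<Rightarrow> complex ^ 'n \<Rightarrow> 'a::real_normed_vector" where
  "d_y k F z = vector_derivative (\<lambda>t::real. F (z + t *\<^sub>R axis k \<i>)) (at 0)"

definition d_z :: "'n \<Rightarrow> (complex ^ 'n \<Rightarrow> complex) \<Rightarrow> complex ^ 'n \<Rightarrow> complex" where
  "d_z k F z = 1/2 * (d_x k F z - \<i> * d_y k F z)"

definition d_zbar :: "'n \<Rightarrow> (complex ^ 'n \<Rightarrow> complex) \<Rightarrow> complex ^ 'n \<Rightarrow> complex" where
  "d_zbar k F z = 1/2 * (d_x k F z + \<i> * d_y k F z)"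

definition d_r :: "'n + 'n \<Rightarrow> (complex ^ 'n \<Rightarrow> 'a) \<Rightarrow> complex ^ 'n \<Rightarrow> 'a::real_normed_vector" where
  "d_r l = (case l of Inl k \<Rightarrow> d_x k | Inr k \<Rightarrow> d_y k)"

definition d_c :: "'n + 'n \<Rightarrow> (complex ^ 'n \<Rightarrow> complex) \<Rightarrow> complex ^ 'n \<Rightarrow> complex" where
  "d_c l = (case l of Inl k \<Rightarrow> d_z k | Inr k \<Rightarrow> d_zbar k)"

text \<open>In the next two definitions \<open>D\<close> is a row operator, given by its component operators.\<close>

definition op_row :: "('l \<Rightarrow> ('p \<Rightarrow> 'a) \<Rightarrow> 'p \<Rightarrow> 'a) \<Rightarrow> ('p \<Rightarrow> 'a) \<Rightarrow> 'p \<Rightarrow> 'a ^ 'l" where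
  "op_row D g z = (\<chi> l. D l g z)"

definition op_mat ::
  "('l \<Rightarrow> ('p \<Rightarrow> 'a) \<Rightarrow> 'p \<Rightarrow> 'a) \<Rightarrow> ('p \<Rightarrow> 'a ^ 'm) \<Rightarrow> 'p \<Rightarrow> 'a ^ 'l ^ 'm" where
  "op_mat D F z = (\<chi> k l. D l (\<lambda>w. F w $ k) z)"

definition grad_r :: "(complex ^ 'n \<Rightarrow> real) \<Rightarrow> complex ^ 'n \<Rightarrow> real ^ ('n + 'n)" where
  "grad_r f = op_row d_r f"

definition grad_c :: "(complex ^ 'n \<Rightarrow> real) \<Rightarrow> complex ^ 'n \<Rightarrow> complex ^ ('n + 'n)" where
  "grad_c f = op_row d_c (\<lambda>w. complex_of_real (f w))"

definition hess_rr :: "(complex ^ 'n \<Rightarrow> real) \<Rightarrow> complex ^ 'n \<Rightarrow> real ^ ('n + 'n) ^ ('n + 'n)" where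
  "hess_rr f = op_mat d_r (grad_r f)"

definition hess_cc_C ::
  "(complex ^ 'n \<Rightarrow> real) \<Rightarrow> complex ^ 'n \<Rightarrow> complex ^ ('n + 'n) ^ ('n + 'n)" where
  "hess_cc_C f = op_mat d_c (\<lambda>w. conj_vec (grad_c f w))"

definition hess_cc_R ::
  "(complex ^ 'n \<Rightarrow> real) \<Rightarrow> complex ^ 'n \<Rightarrow> complex ^ ('n + 'n) ^ ('n + 'n)" where
  "hess_cc_R f = op_mat d_c (grad_c f)"

definition newton_r :: "(complex ^ 'n \<Rightarrow> real) \<Rightarrow> complex ^ 'n \<Rightarrow> real ^ ('n + 'n)" where
  "newton_r f p = - (matrix_inv (hess_rr f p) *v grad_r f p)"

definition newton_c_C :: "(complex ^ 'n \<Rightarrow> real) \<Rightarrow> complex ^ 'n \<Rightarrow> complex ^ ('n + 'n)" where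
  "newton_c_C f p = - (matrix_inv (hess_cc_C f p) *v conj_vec (grad_c f p))"

definition newton_c_R :: "(complex ^ 'n \<Rightarrow> real) \<Rightarrow> complex ^ 'n \<Rightarrow> complex ^ ('n + 'n)" where
  "newton_c_R f p = - (matrix_inv (hess_cc_R f p) *v grad_c f p)"

end

theory Submission
  imports Defs
begin

text \<open>With \<open>W = J\<^sup>H/2\<close> the row operator is \<open>\<partial>/\<partial>c = (\<partial>/\<partial>r) W\<close>. Hence both complex gradients have
  the form \<open>B g\<close> with \<open>g\<close> the real gradient (\<open>B = J/2\<close> for the conjugated one, \<open>B = cnj J/2\<close> for
  the other), and both Hessians have the form \<open>B H W\<close> with \<open>H\<close> the real Hessian. Since \<open>W J = 1\<close>,
  the vector \<open>J \<Delta>r\<close> solves both complex Newton equations.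
  Analyticity only serves to make these identities meaningful: first partial derivatives must
  exist everywhere and second ones at the point, which follows from the power series
  restricted to coordinate lines and planes through its centre.\<close>

section \<open>Partial derivatives of analytic functions\<close>

text \<open>Termwise differentiation inside the radius of convergence, transferred to
  \<open>h\<close>, which agrees with the series on an open interval.\<close>

lemma has_sum_powser_derivative:
  fixes c :: "nat \<Rightarrow> real"
  assumes sum: "\<And>t. \<bar>t\<bar> < e \<Longrightarrow> ((\<lambda>n. c n * t ^ n) has_sum h t) UNIV" and t: "\<bar>t\<bar> < e"
  shows "(h has_real_derivative (\<Sum>n. diffs c n * t ^ n)) (at t)"
proof -
  have sums: "(\<lambda>n. c n * s ^ n) sums h s" if "\<bar>s\<bar> < e" for s
    using sum[OF that] by (rule has_sum_imp_sums)
  \<comment> \<open>Convergence at a point strictly beyond \<open>\<bar>t\<bar>\<close> permits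
    termwise differentiation at \<open>t\<close>.\<close>
  define K where "K = (\<bar>t\<bar> + e) / 2"
  have K: "\<bar>t\<bar> < K" "K < e" "0 < K" using t by (auto simp: K_def)
  have "((\<lambda>s. \<Sum>n. c n * s ^ n) has_real_derivative (\<Sum>n. diffs c n * t ^ n)) (at t)"
    by (rule termdiffs_strong[of _ K]) (use K sums[of K] in \<open>auto simp: sums_iff\<close>)
  then show ?thesis
  proof (rule has_field_derivative_transform_within_open)
    show "open {-e<..<e}" "t \<in> {-e<..<e}" using t by auto
    show "(\<Sum>n. c n * s ^ n) = h s" if "s \<in> {-e<..<e}" for s
      using sums[of s] that by (simp add: sums_iff abs_less_iff)
  qed
qed

lemma has_sum_powser_derivative_0:
  fixes c :: "nat \<Rightarrow> real"
  assumes "\<And>t. \<bar>t\<bar> < e \<Longrightarrow> ((\<lambda>n. c n * t ^ n) has_sum h t) UNIV" and "0 < e"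
  shows "(h has_real_derivative c 1) (at 0)"
  using has_sum_powser_derivative[OF assms(1), of e 0] assms(2)
  by (simp add: powser_zero diffs_def)

text \<open>Near 0 the derivative of \<open>h\<close> is the \<open>diffs\<close> series, which
  again converges there and can be differentiated once more. This serves the pure second
  partials.\<close>

lemma has_sum_powser_deriv_differentiable_0:
  fixes c :: "nat \<Rightarrow> real"
  assumes sum: "\<And>t. \<bar>t\<bar> < e \<Longrightarrow> ((\<lambda>n. c n * t ^ n) has_sum h t) UNIV" and e: "0 < e"
  shows "(\<lambda>t. vector_derivative h (at t)) differentiable (at 0)"
proof -
  have summable_c: "summable (\<lambda>n. c n * t ^ n)" if "\<bar>t\<bar> < e" for t
    using has_sum_imp_sums[OF sum[OF that]] by (simp add: sums_iff)
  have summable_diffs: "summable (\<lambda>n. diffs c n * t ^ n)" if "\<bar>t\<bar> < e" for t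
    by (rule termdiff_converges[of _ e]) (use that summable_c in auto)
  have "((\<lambda>s. \<Sum>n. diffs c n * s ^ n) has_real_derivative (\<Sum>n. diffs (diffs c) n * 0 ^ n)) (at 0)"
    by (rule termdiffs_strong[of _ "e/2"]) (use e summable_diffs[of "e/2"] in auto)
  then have "((\<lambda>t. vector_derivative h (at t)) has_real_derivative
      (\<Sum>n. diffs (diffs c) n * 0 ^ n)) (at 0)"
  proof (rule has_field_derivative_transform_within_open)
    show "open {-e<..<e}" "0 \<in> {-e<..<e}" using e by auto
    show "(\<Sum>n. diffs c n * s ^ n) = vector_derivative h (at s)" if "s \<in> {-e<..<e}" for s
      using has_sum_powser_derivative[OF sum, of e s] that
      by (intro vector_derivative_at[symmetric])
        (auto simp: has_real_derivative_iff_has_vector_derivative abs_less_iff)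
  qed
  then show ?thesis by (rule differentiableI[OF has_field_derivative_imp_has_derivative])
qed

text \<open>Serves the mixed second partials. Summing over \<open>j\<close> first leaves a power
  series in \<open>s\<close>; its linear coefficient is the \<open>s\<close>-derivative at 0 and is
  itself a power series in \<open>t\<close>.\<close>

lemma has_sum_powser2_deriv_differentiable_0:
  fixes a :: "nat \<Rightarrow> nat \<Rightarrow> real"
  assumes sum: "\<And>s t. \<bar>s\<bar> + \<bar>t\<bar> < e \<Longrightarrow> ((\<lambda>(i, j). a i j * (s ^ i * t ^ j)) has_sum G s t) UNIV"
    and e: "0 < e"
  shows "(\<lambda>t. vector_derivative (\<lambda>s. G s t) (at 0)) differentiable (at 0)"
proof -
  define b where "b t i = infsum (\<lambda>j. a i j * t ^ j) UNIV" for t i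
  have sum': "((\<lambda>(i, j). a i j * (s ^ i * t ^ j)) has_sum G s t) (UNIV \<times> UNIV)"
    if "\<bar>s\<bar> + \<bar>t\<bar> < e" for s t
    using sum[OF that] by simp
  \<comment> \<open>Each row is a subfamily of a summable double family, hence summable by
    completeness.\<close>
  have inner: "(\<lambda>j. a i j * (s ^ i * t ^ j)) summable_on UNIV" if "\<bar>s\<bar> + \<bar>t\<bar> < e" for s t i
  proof -
    have "(\<lambda>(i, j). a i j * (s ^ i * t ^ j)) summable_on (UNIV \<times> UNIV)"
      using sum'[OF that] by (auto simp: summable_on_def)
    then have "(\<lambda>(i, j). a i j * (s ^ i * t ^ j)) summable_on (Pair i ` UNIV)"
      by (rule summable_on_subset_banach) auto
    then show ?thesis
      by (subst (asm) summable_on_reindex) (auto simp: inj_on_def o_def)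
  qed
  have outer: "((\<lambda>i. b t i * s ^ i) has_sum G s t) UNIV" if "\<bar>s\<bar> + \<bar>t\<bar> < e" for s t
  proof -
    have "((\<lambda>i. infsum (\<lambda>j. a i j * (s ^ i * t ^ j)) UNIV) has_sum G s t) UNIV"
      by (rule has_sum_SigmaD[OF sum'[OF that]]) (use inner[OF that] in auto)
    also have "(\<lambda>i. infsum (\<lambda>j. a i j * (s ^ i * t ^ j)) UNIV) = (\<lambda>i. b t i * s ^ i)"
      by (simp add: b_def mult_ac flip: infsum_cmult_right')
    finally show ?thesis .
  qed
  have deriv: "vector_derivative (\<lambda>s. G s t) (at 0) = b t 1" if "\<bar>t\<bar> < e" for t
  proof (rule vector_derivative_at)
    \<comment> \<open>For fixed \<open>t\<close> the series in \<open>s\<close> is available for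
      \<open>\<bar>s\<bar> < e - \<bar>t\<bar>\<close>.\<close>
    have "((\<lambda>s. G s t) has_real_derivative b t 1) (at 0)"
      by (rule has_sum_powser_derivative_0[of "e - \<bar>t\<bar>"]) (use outer that in auto)
    then show "((\<lambda>s. G s t) has_vector_derivative b t 1) (at 0)"
      by (simp add: has_real_derivative_iff_has_vector_derivative)
  qed
  have sum1: "((\<lambda>j. a 1 j * t ^ j) has_sum b t 1) UNIV" if "\<bar>t\<bar> < e" for t
  proof -
    \<comment> \<open>A nonzero admissible \<open>s\<close>, so that the factor \<open>s ^ 1\<close>
      can be divided out of row 1.\<close>
    define s where "s = (e - \<bar>t\<bar>) / 2"
    have "0 < s" "s + \<bar>t\<bar> < e" using that by (simp_all add: s_def field_simps)
    then have s: "s \<noteq> 0" "\<bar>s\<bar> + \<bar>t\<bar> < e" by auto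
    have "(\<lambda>j. inverse s * (a 1 j * (s ^ 1 * t ^ j))) summable_on UNIV"
      by (rule summable_on_cmult_right[OF inner[OF s(2)]])
    then have "(\<lambda>j. a 1 j * t ^ j) summable_on UNIV" using s(1) by (simp add: field_simps)
    then show ?thesis unfolding b_def by (rule has_sum_infsum)
  qed
  have "((\<lambda>t. b t 1) has_real_derivative a 1 1) (at 0)"
    by (rule has_sum_powser_derivative_0[of e]) (use sum1 e in auto)
  then have "((\<lambda>t. vector_derivative (\<lambda>s. G s t) (at 0)) has_real_derivative a 1 1) (at 0)"
    by (rule has_field_derivative_transform_within_open[of _ _ _ "{-e<..<e}"])
      (use e deriv in \<open>auto simp: abs_less_iff\<close>)
  then show ?thesis by (rule differentiableI[OF has_field_derivative_imp_has_derivative])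
qed

text \<open>On a coordinate line through the centre only the pure powers of the \<open>k\<close>-th
  coordinate survive; \<open>\<phi>\<close> embeds their exponents into the multi-indices.\<close>

lemma real_analytic_axis_has_sum:
  fixes g :: "real ^ 'm \<Rightarrow> real"
  assumes "real_analytic g"
  obtains e c where "0 < e"
    "\<And>t. \<bar>t\<bar> < e \<Longrightarrow> ((\<lambda>n. c n * t ^ n) has_sum g (x + t *\<^sub>R axis k 1)) UNIV"
proof -
  obtain e a where e: "0 < e" and sum: "\<And>y. y \<in> ball x e \<Longrightarrow>
     ((\<lambda>\<alpha>. a \<alpha> * (\<Prod>i\<in>UNIV. (y $ i - x $ i) ^ \<alpha> i)) has_sum g y) UNIV"
    using assms unfolding real_analytic_def by metis
  define \<phi> where "\<phi> n = (\<lambda>m. if m = k then n else 0)" for n :: nat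
  have inj: "inj \<phi>" by (auto simp: inj_def \<phi>_def fun_eq_iff)
  have "((\<lambda>n. a (\<phi> n) * t ^ n) has_sum g (x + t *\<^sub>R axis k 1)) UNIV" if t: "\<bar>t\<bar> < e" for t
  proof -
    let ?y = "x + t *\<^sub>R axis k 1"
    let ?f = "\<lambda>\<alpha>. a \<alpha> * (\<Prod>i\<in>UNIV. (?y $ i - x $ i) ^ \<alpha> i)"
    have "?y \<in> ball x e" using t by (simp add: dist_norm norm_axis_1)
    then have "(?f has_sum g ?y) UNIV" by (rule sum)
    moreover have "?f \<alpha> = 0" if "\<alpha> \<notin> range \<phi>" for \<alpha>
    proof -
      have "\<alpha> \<noteq> \<phi> (\<alpha> k)" using that by blast
      \<comment> \<open>A positive exponent off the line is applied to a zero coordinate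
        difference.\<close>
      then obtain m where "m \<noteq> k" "\<alpha> m \<noteq> 0" by (auto simp: \<phi>_def fun_eq_iff split: if_splits)
      then have "(\<Prod>i\<in>UNIV. (?y $ i - x $ i) ^ \<alpha> i) = 0"
        by (intro prod_zero) (auto simp: axis_def intro!: bexI[of _ m])
      then show ?thesis by simp
    qed
    ultimately have "(?f has_sum g ?y) (range \<phi>)"
      by (subst (asm) has_sum_cong_neutral[of "range \<phi>" UNIV ?f ?f]) auto
    then have "((?f \<circ> \<phi>) has_sum g ?y) UNIV" using inj by (simp add: has_sum_reindex)
    moreover have "?f \<circ> \<phi> = (\<lambda>n. a (\<phi> n) * t ^ n)"
    proof
      fix n
      \<comment> \<open>The other factors have exponent 0 and equal 1, including
        \<open>0 ^ 0\<close>.\<close>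
      have "(\<Prod>i\<in>UNIV. (?y $ i - x $ i) ^ \<phi> n i) = (\<Prod>i\<in>{k}. (?y $ i - x $ i) ^ \<phi> n i)"
        by (rule prod.mono_neutral_right) (auto simp: \<phi>_def)
      then show "(?f \<circ> \<phi>) n = a (\<phi> n) * t ^ n" by (simp add: \<phi>_def)
    qed
    ultimately show ?thesis by simp
  qed
  then show ?thesis by (rule that[OF e])
qed

text \<open>The same selection of monomials with two active coordinates. The triangle inequality
  turns the bound on \<open>\<bar>s\<bar> + \<bar>t\<bar>\<close> into membership in the ball, and
  \<open>k \<noteq> l\<close> makes \<open>\<phi>\<close> injective.\<close>

lemma real_analytic_plane_has_sum:
  fixes g :: "real ^ 'm \<Rightarrow> real"
  assumes "real_analytic g" and kl: "k \<noteq> l"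
  obtains e a where "0 < e" "\<And>s t. \<bar>s\<bar> + \<bar>t\<bar> < e \<Longrightarrow>
    ((\<lambda>(i, j). a i j * (s ^ i * t ^ j)) has_sum g (x + t *\<^sub>R axis l 1 + s *\<^sub>R axis k 1)) UNIV"
proof -
  obtain e a where e: "0 < e" and sum: "\<And>y. y \<in> ball x e \<Longrightarrow>
     ((\<lambda>\<alpha>. a \<alpha> * (\<Prod>i\<in>UNIV. (y $ i - x $ i) ^ \<alpha> i)) has_sum g y) UNIV"
    using assms unfolding real_analytic_def by metis
  define \<phi> where "\<phi> = (\<lambda>(i::nat, j::nat) m. if m = k then i else if m = l then j else 0)"
  have inj: "inj \<phi>"
    using kl by (auto simp: inj_def \<phi>_def fun_eq_iff)
  have "((\<lambda>(i, j). a (\<phi> (i, j)) * (s ^ i * t ^ j)) has_sum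
      g (x + t *\<^sub>R axis l 1 + s *\<^sub>R axis k 1)) UNIV" if st: "\<bar>s\<bar> + \<bar>t\<bar> < e" for s t
  proof -
    let ?y = "x + t *\<^sub>R axis l 1 + s *\<^sub>R axis k 1"
    let ?f = "\<lambda>\<alpha>. a \<alpha> * (\<Prod>i\<in>UNIV. (?y $ i - x $ i) ^ \<alpha> i)"
    have "dist x ?y = norm (t *\<^sub>R axis l 1 + s *\<^sub>R axis k (1::real))"
      by (simp add: dist_norm norm_minus_commute algebra_simps)
    also have "\<dots> \<le> \<bar>t\<bar> + \<bar>s\<bar>"
      by (rule order.trans[OF norm_triangle_ineq]) (simp add: norm_axis_1)
    finally have "?y \<in> ball x e" using st by simp
    then have "(?f has_sum g ?y) UNIV" by (rule sum)
    moreover have "?f \<alpha> = 0" if "\<alpha> \<notin> range \<phi>" for \<alpha>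
    proof -
      have "\<alpha> \<noteq> \<phi> (\<alpha> k, \<alpha> l)" using that by blast
      then obtain m where "m \<noteq> k" "m \<noteq> l" "\<alpha> m \<noteq> 0"
        by (auto simp: \<phi>_def fun_eq_iff split: if_splits)
      then have "(\<Prod>i\<in>UNIV. (?y $ i - x $ i) ^ \<alpha> i) = 0"
        by (intro prod_zero) (auto simp: axis_def intro!: bexI[of _ m])
      then show ?thesis by simp
    qed
    ultimately have "(?f has_sum g ?y) (range \<phi>)"
      by (subst (asm) has_sum_cong_neutral[of "range \<phi>" UNIV ?f ?f]) auto
    then have "((?f \<circ> \<phi>) has_sum g ?y) UNIV" using inj by (simp add: has_sum_reindex)
    moreover have "?f \<circ> \<phi> = (\<lambda>(i, j). a (\<phi> (i, j)) * (s ^ i * t ^ j))"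
    proof
      fix ij :: "nat \<times> nat"
      obtain i j where ij: "ij = (i, j)" by force
      have "(\<Prod>i\<in>UNIV. (?y $ i - x $ i) ^ \<phi> ij i) = (\<Prod>i\<in>{k, l}. (?y $ i - x $ i) ^ \<phi> ij i)"
        by (rule prod.mono_neutral_right) (auto simp: \<phi>_def ij)
      then show "(?f \<circ> \<phi>) ij = (\<lambda>(i, j). a (\<phi> (i, j)) * (s ^ i * t ^ j)) ij"
        using kl by (simp add: \<phi>_def ij axis_def)
    qed
    ultimately show ?thesis by simp
  qed
  then show ?thesis by (rule that[OF e, of "\<lambda>i j. a (\<phi> (i, j))"])
qed

lemma real_analytic_partial_differentiable:
  fixes g :: "real ^ 'm \<Rightarrow> real"
  assumes "real_analytic g"
  shows "(\<lambda>t. g (x + t *\<^sub>R axis k 1)) differentiable (at 0)"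
proof -
  obtain e c where "0 < e"
    "\<And>t. \<bar>t\<bar> < e \<Longrightarrow> ((\<lambda>n. c n * t ^ n) has_sum g (x + t *\<^sub>R axis k 1)) UNIV"
    using real_analytic_axis_has_sum[OF assms, of x k] by metis
  then have "((\<lambda>t. g (x + t *\<^sub>R axis k 1)) has_real_derivative c 1) (at 0)"
    by (intro has_sum_powser_derivative_0[of e])
  then show ?thesis by (rule differentiableI[OF has_field_derivative_imp_has_derivative])
qed

lemma real_analytic_partial2_differentiable:
  fixes g :: "real ^ 'm \<Rightarrow> real"
  assumes "real_analytic g"
  shows "(\<lambda>t. vector_derivative (\<lambda>s. g (x + t *\<^sub>R axis l 1 + s *\<^sub>R axis k 1)) (at 0))
    differentiable (at 0)"
proof (cases "k = l")
  case True
  define h where "h = (\<lambda>s. g (x + s *\<^sub>R axis k 1))"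
  have diff: "(\<lambda>t. vector_derivative h (at t)) differentiable (at 0)"
  proof -
    obtain e c where "0 < e" "\<And>t. \<bar>t\<bar> < e \<Longrightarrow> ((\<lambda>n. c n * t ^ n) has_sum h t) UNIV"
      unfolding h_def using real_analytic_axis_has_sum[OF assms, of x k] by metis
    then show ?thesis by (intro has_sum_powser_deriv_differentiable_0[of e])
  qed
  \<comment> \<open>With equal directions, moving the base point by \<open>t\<close> merely shifts
    the argument of \<open>h\<close>.\<close>
  have "vector_derivative (\<lambda>s. h (s + t)) (at 0) = vector_derivative h (at t)" for t
    using DERIV_shift[of h _ 0 t]
    by (simp add: vector_derivative_def flip: has_real_derivative_iff_has_vector_derivative)
  moreover have "h (s + t) = g (x + t *\<^sub>R axis l 1 + s *\<^sub>R axis k 1)" for s t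
    by (simp add: h_def True algebra_simps)
  ultimately have "vector_derivative h (at t) =
      vector_derivative (\<lambda>s. g (x + t *\<^sub>R axis l 1 + s *\<^sub>R axis k 1)) (at 0)" for t
    by simp
  then show ?thesis using diff by simp
next
  case False
  obtain e a where e: "0 < e" and sum: "\<And>s t. \<bar>s\<bar> + \<bar>t\<bar> < e \<Longrightarrow>
    ((\<lambda>(i, j). a i j * (s ^ i * t ^ j)) has_sum g (x + t *\<^sub>R axis l 1 + s *\<^sub>R axis k 1)) UNIV"
    by (rule real_analytic_plane_has_sum[OF assms False, where x = x], rule that)
  show ?thesis by (rule has_sum_powser2_deriv_differentiable_0[OF sum e])
qed

section \<open>The Newton equations\<close>

definition W_mat :: "complex ^ ('n::finite + 'n) ^ ('n + 'n)" where
  "W_mat = (\<chi> m l. cnj (J_mat $ l $ m) / 2)"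

lemma sum_UNIV_Plus:
  "(\<Sum>i\<in>(UNIV :: ('a::finite + 'b::finite) set). h i) = (\<Sum>k\<in>UNIV. h (Inl k)) + (\<Sum>k\<in>UNIV. h (Inr k))"
  by (simp add: sum.Plus flip: UNIV_Plus_UNIV)

text \<open>This is what places the updates in \<open>C_space\<close>.\<close>

lemma J_mat_of_real_vec: "J_mat *v of_real_vec r = augment (complexify r)"
proof -
  have "(J_mat *v of_real_vec r) $ i = augment (complexify r) $ i" for i
    by (cases i) (simp_all add: matrix_vector_mult_def J_mat_def of_real_vec_def augment_def
        complexify_def sum_UNIV_Plus mat_def if_distrib if_distribR complex_eq_iff cong: if_cong)
  then show ?thesis by (simp add: vec_eq_iff)
qed

text \<open>The identity \<open>W J = 1\<close>, applied to real vectors.\<close>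

lemma W_mat_augment_complexify: "W_mat *v augment (complexify r) = of_real_vec r"
proof -
  have "(W_mat *v augment (complexify r)) $ i = of_real_vec r $ i" for i
    by (cases i) (simp_all add: matrix_vector_mult_def W_mat_def J_mat_def of_real_vec_def augment_def
        complexify_def sum_UNIV_Plus mat_def if_distrib if_distribR complex_eq_iff cong: if_cong)
  then show ?thesis by (simp add: vec_eq_iff)
qed

lemma map_matrix_of_real_vec:
  "map_matrix complex_of_real A *v of_real_vec v = of_real_vec (A *v v)"
  by (simp add: matrix_vector_mult_def of_real_vec_def vec_eq_iff map_matrix_def)

lemma complexify_line: "complexify (r + t *\<^sub>R v) = complexify r + t *\<^sub>R complexify v"
  by (simp add: complexify_def vec_eq_iff complex_eq_iff)

lemma surj_complexify: "surj complexify"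
proof (rule surjI)
  show "complexify (\<chi> i. case i of Inl k \<Rightarrow> Re (z $ k) | Inr k \<Rightarrow> Im (z $ k)) = z" for z
    by (simp add: complexify_def vec_eq_iff)
qed

text \<open>Treats both kinds of real partials uniformly as derivatives along images of real axes,
  the form in which analyticity is available.\<close>

lemma d_r_eq: "d_r l F z = vector_derivative (\<lambda>t. F (z + t *\<^sub>R complexify (axis l 1))) (at 0)"
proof -
  have "complexify (axis l 1) = (case l of Inl k \<Rightarrow> axis k 1 | Inr k \<Rightarrow> axis k \<i>)"
    by (auto simp: complexify_def axis_def vec_eq_iff complex_eq_iff split: sum.split)
  then show ?thesis
    by (simp add: d_r_def d_x_def d_y_def split: sum.split)
qed

lemma d_c_eq: "d_c l F z = (\<Sum>m\<in>UNIV. W_mat $ m $ l * d_r m F z)"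
  by (cases l) (simp_all add: d_c_def d_z_def d_zbar_def d_r_def W_mat_def J_mat_def sum_UNIV_Plus
      mat_def if_distrib if_distribR algebra_simps cong: if_cong)

text \<open>\<open>vector_derivative\<close> is an arbitrary choice where no derivative exists, so
  linearity relies on differentiability.\<close>

lemma d_r_linear_combination:
  fixes G :: "'k::finite \<Rightarrow> complex ^ 'n \<Rightarrow> real"
  assumes "\<And>k. (\<lambda>t. G k (z + t *\<^sub>R complexify (axis l 1))) differentiable (at 0)"
  shows "d_r l (\<lambda>w. \<Sum>k\<in>UNIV. b k * complex_of_real (G k w)) z =
    (\<Sum>k\<in>UNIV. b k * complex_of_real (d_r l (G k) z))"
  unfolding d_r_eq
  by (rule vector_derivative_at, intro has_vector_derivative_sum has_vector_derivative_mult_right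
      has_vector_derivative_of_real)
    (use assms in \<open>auto simp: has_real_derivative_iff_has_vector_derivative vector_derivative_works\<close>)

lemma d_r_of_real:
  assumes "(\<lambda>t. f (z + t *\<^sub>R complexify (axis l 1))) differentiable (at 0)"
  shows "d_r l (\<lambda>w. complex_of_real (f w)) z = complex_of_real (d_r l f z)"
  using d_r_linear_combination[of "\<lambda>_::unit. f" z l "\<lambda>_. 1"] assms by simp

text \<open>The constant \<open>B\<close> passes through the derivatives as a left factor, while
  expanding \<open>d_c\<close> in real partials puts \<open>W_mat\<close> on the right.\<close>

lemma op_mat_d_c_grad_r:
  assumes "\<And>k l. (\<lambda>t. grad_r f (p + t *\<^sub>R complexify (axis l 1)) $ k) differentiable (at 0)"
  shows "op_mat d_c (\<lambda>w. B *v of_real_vec (grad_r f w)) p =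
    B ** (map_matrix complex_of_real (hess_rr f p) ** W_mat)"
proof -
  have "op_mat d_c (\<lambda>w. B *v of_real_vec (grad_r f w)) p $ k $ l =
    (\<Sum>m\<in>UNIV. W_mat $ m $ l * (\<Sum>n\<in>UNIV. B $ k $ n * complex_of_real (hess_rr f p $ n $ m)))" for k l
    using assms
    by (simp add: op_mat_def d_c_eq matrix_vector_mult_def of_real_vec_def hess_rr_def
        d_r_linear_combination)
  then show ?thesis
    \<comment> \<open>Associating to the left makes the nesting of the sums agree.\<close>
    by (simp add: vec_eq_iff matrix_mul_assoc matrix_matrix_mult_def[of "B ** _"])
      (simp add: matrix_matrix_mult_def map_matrix_def mult_ac)
qed

lemma matrix_vector_mult_uminus:
  fixes A :: "'a::ring_1 ^ 'n ^ 'm"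
  shows "A *v (- x) = - (A *v x)"
  using matrix_vector_mult_diff_distrib[of A 0 x] by simp

lemma matrix_inv_inverse:
  assumes "invertible A"
  shows "A ** matrix_inv A = mat 1" "matrix_inv A ** A = mat 1"
  using someI_ex[OF assms[unfolded invertible_def]] by (simp_all add: matrix_inv_def)

text \<open>Reduces each complex update to checking that a candidate solves the Newton
  equation.\<close>

lemma newton_solution:
  fixes H :: "'a::ring_1 ^ 'n ^ 'm"
  assumes "invertible H" and "H *v v = - g"
  shows "- (matrix_inv H *v g) = v"
proof -
  have "- (matrix_inv H *v g) = matrix_inv H *v (H *v v)"
    by (simp add: assms(2) matrix_vector_mult_uminus)
  also have "\<dots> = v"
    using matrix_inv_inverse[OF assms(1)] by (simp add: matrix_vector_mul_assoc)
  finally show ?thesis .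
qed

text \<open>One argument for both complex updates: \<open>G\<close> is either gradient, and
  \<open>B\<close> carries the real Newton equation to the complex one.\<close>

lemma newton_c_eq_J_newton_r:
  assumes diff: "\<And>k l. (\<lambda>t. grad_r f (p + t *\<^sub>R complexify (axis l 1)) $ k) differentiable (at 0)"
    and inv: "invertible (hess_rr f p)"
    and G: "\<And>w. G w = B *v of_real_vec (grad_r f w)"
    and invG: "invertible (op_mat d_c G p)"
  shows "- (matrix_inv (op_mat d_c G p) *v G p) = J_mat *v of_real_vec (newton_r f p)"
proof (rule newton_solution[OF invG])
  have G': "G = (\<lambda>w. B *v of_real_vec (grad_r f w))" using G by auto
  have newton: "hess_rr f p *v newton_r f p = - grad_r f p"
    using matrix_inv_inverse[OF inv] by (simp add: newton_r_def matrix_vector_mult_uminus matrix_vector_mul_assoc)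
  have "op_mat d_c G p *v (J_mat *v of_real_vec (newton_r f p)) =
      B *v (map_matrix complex_of_real (hess_rr f p) *v (W_mat *v augment (complexify (newton_r f p))))"
    unfolding G' op_mat_d_c_grad_r[OF diff] J_mat_of_real_vec
    by (simp add: matrix_vector_mul_assoc matrix_mul_assoc)
  also have "\<dots> = B *v of_real_vec (- grad_r f p)"
    by (simp add: W_mat_augment_complexify map_matrix_of_real_vec newton)
  also have "of_real_vec (- grad_r f p) = - of_real_vec (grad_r f p)"
    by (simp add: of_real_vec_def vec_eq_iff)
  finally show "op_mat d_c G p *v (J_mat *v of_real_vec (newton_r f p)) = - G p"
    by (simp only: matrix_vector_mult_uminus G[of p])
qed

theorem mainTheorem5:
  fixes f :: "complex ^ 'n \<Rightarrow> real" and p :: "complex ^ 'n"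
  assumes "real_analytic (\<lambda>r. f (complexify r))"
    and "invertible (hess_rr f p)"
    and "invertible (hess_cc_C f p)"
    and "invertible (hess_cc_R f p)"
  shows "newton_c_C f p \<in> C_space
    \<and> newton_c_C f p = newton_c_R f p
    \<and> newton_c_R f p = J_mat *v of_real_vec (newton_r f p)"
proof -
  \<comment> \<open>Required at every \<open>z\<close>, since the gradient formulas below are
    differentiated as identities of functions.\<close>
  have diff: "(\<lambda>t. f (z + t *\<^sub>R complexify (axis l 1))) differentiable (at 0)" for z l
  proof -
    obtain r where "z = complexify r" using surj_complexify by blast
    then show ?thesis
      using real_analytic_partial_differentiable[OF assms(1), of r l] by (simp add: complexify_line)
  qed
  have diff2: "(\<lambda>t. grad_r f (p + t *\<^sub>R complexify (axis l 1)) $ k) differentiable (at 0)" for k l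
  proof -
    obtain r where "p = complexify r" using surj_complexify by blast
    then show ?thesis
      using real_analytic_partial2_differentiable[OF assms(1), of r l k]
      by (simp add: complexify_line grad_r_def op_row_def d_r_eq)
  qed
  have grad_c: "grad_c f w = transpose W_mat *v of_real_vec (grad_r f w)" for w
    by (simp add: vec_eq_iff grad_c_def grad_r_def op_row_def d_c_eq d_r_of_real[OF diff]
        matrix_vector_mult_def transpose_def of_real_vec_def)
  \<comment> \<open>The real gradient is fixed by conjugation, so only the matrix is
    conjugated.\<close>
  have conj_grad_c:
    "conj_vec (grad_c f w) = map_matrix cnj (transpose W_mat) *v of_real_vec (grad_r f w)" for w
    by (simp add: vec_eq_iff grad_c conj_vec_def map_matrix_def matrix_vector_mult_def of_real_vec_def)
  have C: "newton_c_C f p = J_mat *v of_real_vec (newton_r f p)"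
    unfolding newton_c_C_def hess_cc_C_def
    by (rule newton_c_eq_J_newton_r[OF diff2 assms(2) conj_grad_c assms(3)[unfolded hess_cc_C_def]])
  have R: "newton_c_R f p = J_mat *v of_real_vec (newton_r f p)"
    unfolding newton_c_R_def hess_cc_R_def
    by (rule newton_c_eq_J_newton_r[OF diff2 assms(2) grad_c assms(4)[unfolded hess_cc_R_def]])
  show ?thesis using C R by (simp add: J_mat_of_real_vec C_space_def)
qed

end
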